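(* Let $\{X(t),t\ge 0\}$ be a centered Gaussian process with almost surely continuous sample paths, $X(0)=0$ and stationary increments, and let $\sigma^2(t)=\mathrm{Var}(X(t))$. Suppose that $\sigma^2(\cdot)$ is differentiable, strictly increasing and convex. Let $c>0$. Then for any bounded measurable function $T_u>0$ (of $u\ge 0$) and any $S>0$, $$\lim_{u\to\infty}\frac{\log\big(\mathcal{P}_S(u,T_u)\big)}{u^2}=-\frac{1}{2\sigma^2(S)}.$$
   Context: For $u\ge 0$ and premium rate $c>0$ the risk process is $R_u(t)=u+ct-X(t)$, $t\ge 0$. The probability of Parisian ruin over $[0,S]$ is $$\mathcal{P}_S(u,T_u)=\mathbb{P}\Big\{\inf_{t\in[0,S]}\sup_{s\in[t,t+T_u]}R_u(s)<0\Big\}.$$ *)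

theory Defs
  imports "HOL-Probability.Probability"
begin

text \<open>Processes are functions \<open>X :: real \<Rightarrow> 'a \<Rightarrow> real\<close>; only times \<open>t \<ge> 0\<close> are ever used.\<close>

text \<open>Point masses count as (degenerate) Gaussian laws; they are needed, as \<open>X 0 = 0\<close>.\<close>

definition gaussian_law :: "real measure \<Rightarrow> bool" where
  "gaussian_law \<mu> \<longleftrightarrow>
     (\<exists>m. \<mu> = return borel m) \<or>
     (\<exists>m s. s > 0 \<and> \<mu> = density lborel (\<lambda>x. ennreal (normal_density m s x)))"

definition gaussian_process :: "'a measure \<Rightarrow> (real \<Rightarrow> 'a \<Rightarrow> real) \<Rightarrow> bool" where
  "gaussian_process M X \<longleftrightarrow>
     (\<forall>t\<ge>0. X t \<in> borel_measurable M) \<and>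
     (\<forall>I a. finite I \<and> I \<subseteq> {0..} \<longrightarrow>
        gaussian_law (distr M borel (\<lambda>\<omega>. \<Sum>t\<in>I. a t * X t \<omega>)))"

definition centered_process :: "'a measure \<Rightarrow> (real \<Rightarrow> 'a \<Rightarrow> real) \<Rightarrow> bool" where
  "centered_process M X \<longleftrightarrow> (\<forall>t\<ge>0. integrable M (X t) \<and> prob_space.expectation M (X t) = 0)"

definition ae_continuous_paths :: "'a measure \<Rightarrow> (real \<Rightarrow> 'a \<Rightarrow> real) \<Rightarrow> bool" where
  "ae_continuous_paths M X \<longleftrightarrow> (AE \<omega> in M. continuous_on {0..} (\<lambda>t. X t \<omega>))"

text \<open>The increment process started at \<open>h\<close> has the same finite-dimensional distributions
  for every \<open>h \<ge> 0\<close>.\<close>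

definition stationary_increments :: "'a measure \<Rightarrow> (real \<Rightarrow> 'a \<Rightarrow> real) \<Rightarrow> bool" where
  "stationary_increments M X \<longleftrightarrow>
     (\<forall>I h. finite I \<and> I \<subseteq> {0..} \<and> h \<ge> 0 \<longrightarrow>
        distr M (Pi\<^sub>M I (\<lambda>_. borel)) (\<lambda>\<omega>. \<lambda>t\<in>I. X (h + t) \<omega> - X h \<omega>) =
        distr M (Pi\<^sub>M I (\<lambda>_. borel)) (\<lambda>\<omega>. \<lambda>t\<in>I. X t \<omega> - X 0 \<omega>))"

definition variance_function :: "'a measure \<Rightarrow> (real \<Rightarrow> 'a \<Rightarrow> real) \<Rightarrow> real \<Rightarrow> real" where
  "variance_function M X t = prob_space.variance M (X t)"

definition risk_process :: "(real \<Rightarrow> 'a \<Rightarrow> real) \<Rightarrow> real \<Rightarrow> real \<Rightarrow> real \<Rightarrow> 'a \<Rightarrow> real" where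
  "risk_process X c u t \<omega> = u + c * t - X t \<omega>"

text \<open>The infimum and supremum are taken in the extended reals, so that they are meaningful for
  all \<open>\<omega>\<close>. Since paths are only almost surely continuous, the event need only be measurable up
  to a null set, hence the completion of \<open>M\<close>.\<close>

definition parisian_ruin_prob ::
  "'a measure \<Rightarrow> (real \<Rightarrow> 'a \<Rightarrow> real) \<Rightarrow> real \<Rightarrow> real \<Rightarrow> real \<Rightarrow> real \<Rightarrow> real" where
  "parisian_ruin_prob M X c S u T =
     measure (completion M)
       {\<omega> \<in> space M. (INF t\<in>{0..S}. SUP s\<in>{t..t + T}. ereal (risk_process X c u s \<omega>)) < 0}"

end

theory Submission
  imports Defs "HOL-Real_Asymp.Real_Asymp"
begin

text \<open>Write \<open>\<sigma>\<^sup>2\<close> for the variance function.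
  Upper bound: ruin forces \<open>X t > u\<close> for some \<open>t \<in> [0, S]\<close>. On a fixed grid each value has variance
  at most \<open>\<sigma>\<^sup>2(S)\<close>, and dyadic chaining on the grid intervals costs only a fraction \<open>\<epsilon>\<close> of the
  level: convexity gives \<open>\<sigma>\<^sup>2(h) \<le> (h / L) \<sigma>\<^sup>2(L)\<close> for \<open>h \<le> L\<close>, so a fine grid makes the oscillation
  probability negligible.
  Lower bound: it suffices that \<open>X S\<close> exceeds \<open>(1 + \<epsilon>) u\<close> up to a constant and that no dyadic increment
  after \<open>S\<close> is too negative. By convexity these increments are nonnegatively correlated with \<open>X S\<close>, so
  the exceptional event has an exponentially smaller probability than the event for \<open>X S\<close> alone.\<close>

section \<open>Deterministic tools: dyadic chaining and convexity\<close>

text \<open>A dyadic point that is new at level \<open>Suc n\<close> lies one step to the right of a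
  point of level \<open>n\<close>, so going up one level costs at most \<open>b n\<close>. Summing
  over levels bounds \<open>f\<close> on all grid points, and continuity carries the bound to
  \<open>s\<close>. Only steps to the right are controlled, hence the estimate is one-sided.\<close>

lemma dyadic_chaining_bound:
  fixes f :: "real \<Rightarrow> real"
  assumes cont: "continuous_on {a..a + L} f" and L: "L > 0"
    and incr: "\<And>n k. k < 2 ^ n \<Longrightarrow>
      f (a + real (2 * k) * (L / 2 ^ Suc n) + L / 2 ^ Suc n)
        \<le> f (a + real (2 * k) * (L / 2 ^ Suc n)) + b n"
    and b: "\<And>n. b n \<ge> 0" "b sums B"
    and s: "s \<in> {a..a + L}"
  shows "f s \<le> f a + B"
proof -
  have grid: "\<forall>k<2 ^ n. f (a + real k * (L / 2 ^ n)) \<le> f a + (\<Sum>i<n. b i)" for n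
  proof (induction n)
    case (Suc n)
    show ?case
    proof (intro allI impI)
      fix k :: nat assume k: "k < 2 ^ Suc n"
      define j where "j = k div 2"
      have j: "j < 2 ^ n" using k by (simp add: j_def)
      have even_pt: "real (2 * j) * (L / 2 ^ Suc n) = real j * (L / 2 ^ n)" by simp
      have IH: "f (a + real (2 * j) * (L / 2 ^ Suc n)) \<le> f a + (\<Sum>i<n. b i)"
        using Suc j unfolding even_pt by blast
      consider "k = 2 * j" | "k = 2 * j + 1" unfolding j_def by linarith
      then show "f (a + real k * (L / 2 ^ Suc n)) \<le> f a + (\<Sum>i<Suc n. b i)"
      proof cases
        case 1
        then show ?thesis using IH b(1)[of n] by simp
      next
        case 2
        have "a + real k * (L / 2 ^ Suc n) = a + real (2 * j) * (L / 2 ^ Suc n) + L / 2 ^ Suc n"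
          unfolding 2 by (simp add: field_simps)
        then show ?thesis using incr[OF j] IH by (simp only: sum.lessThan_Suc)
      qed
    qed
  qed simp
  have B: "(\<Sum>i<n. b i) \<le> B" for n
    using b by (metis sum_le_suminf sums_iff finite_lessThan)
  show ?thesis
  proof (cases "s = a")
    case True
    then show ?thesis using B[of 0] by simp
  next
    case False
    \<comment> \<open>Ceiling minus one picks the last grid index strictly to the left of
      \<open>s\<close>. It stays below \<open>2 ^ n\<close> even for \<open>s = a + L\<close>, where
      the floor would leave the grid; the price is the separate case \<open>s = a\<close>.\<close>
    define k where "k n = nat (\<lceil>2 ^ n * ((s - a) / L)\<rceil> - 1)" for n
    define x where "x n = a + real (k n) * (L / 2 ^ n)" for n
    have "0 < (s - a) / L" "(s - a) / L \<le> 1" using s False L by auto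
    then have pos: "0 < 2 ^ n * ((s - a) / L)" and le: "2 ^ n * ((s - a) / L) \<le> 2 ^ n" for n
      by (auto simp del: times_divide_eq_right simp: mult_left_le)
    have k: "2 ^ n * ((s - a) / L) - 1 \<le> real (k n)" "real (k n) < 2 ^ n * ((s - a) / L)" for n
      using pos[of n] unfolding k_def by linarith+
    have k_less: "k n < 2 ^ n" for n
      using k(2)[of n] le[of n] by (metis less_le_trans of_nat_less_numeral_power_cancel_iff)
    have x: "s - L / 2 ^ n \<le> x n" "x n \<le> s" for n
    proof -
      have e: "2 ^ n * ((s - a) / L) * (L / 2 ^ n) = s - a" using L by simp
      have "(2 ^ n * ((s - a) / L) - 1) * (L / 2 ^ n) \<le> real (k n) * (L / 2 ^ n)"
        using k(1)[of n] L by (intro mult_right_mono) auto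
      then show "s - L / 2 ^ n \<le> x n"
        unfolding left_diff_distrib e x_def by simp
      have "real (k n) * (L / 2 ^ n) \<le> 2 ^ n * ((s - a) / L) * (L / 2 ^ n)"
        using k(2)[of n] L by (intro mult_right_mono) auto
      then show "x n \<le> s" unfolding e x_def by simp
    qed
    have "(\<lambda>n. s - L / 2 ^ n) \<longlonglongrightarrow> s - 0"
      by (intro tendsto_intros) (rule LIMSEQ_divide_realpow_zero, simp)
    then have lim: "x \<longlonglongrightarrow> s"
      by (intro tendsto_sandwich[OF _ _ _ tendsto_const, of "\<lambda>n. s - L / 2 ^ n" x])
        (use x in auto)
    have in_I: "x n \<in> {a..a + L}" for n
      using x(2)[of n] s L by (auto simp: x_def)
    have "(\<lambda>n. f (x n)) \<longlonglongrightarrow> f s"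
      using cont s lim in_I by (auto simp: continuous_on_sequentially o_def)
    moreover have "f (x n) \<le> f a + B" for n
      using grid[of n] k_less[of n] B[of n] unfolding x_def by fastforce
    ultimately show ?thesis by (intro LIMSEQ_le_const2) auto
  qed
qed

text \<open>The points \<open>x + h\<close> and \<open>x + d\<close> are convex combinations of
  \<open>x\<close> and \<open>x + d + h\<close> with the same two weights interchanged, so adding
  the two convexity inequalities gives the claim.\<close>

lemma convex_on_increment_mono:
  fixes f :: "real \<Rightarrow> real"
  assumes "convex_on {0..} f" "x \<ge> 0" "h \<ge> 0" "d \<ge> 0"
  shows "f (x + h) - f x \<le> f (x + d + h) - f (x + d)"
proof (cases "d + h = 0")
  case True
  then have "d = 0" "h = 0" using assms by linarith+
  then show ?thesis by simp
next
  case False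
  define t where "t = h / (d + h)"
  have dh: "d + h > 0" using False assms by linarith
  have t: "0 \<le> t" "t \<le> 1" using assms dh by (auto simp: t_def field_simps)
  have th: "t * (d + h) = h" using dh by (simp add: t_def)
  have e: "(1 - t) * x + t * (x + d + h) = x + h" "t * x + (1 - t) * (x + d + h) = x + d"
    using th by (simp_all add: algebra_simps)
  have "f (x + h) \<le> (1 - t) * f x + t * f (x + d + h)"
    using convex_onD[OF assms(1), of t x "x + d + h"] t assms e by simp
  moreover have "f (x + d) \<le> t * f x + (1 - t) * f (x + d + h)"
    using convex_onD[OF assms(1), of "1 - t" x "x + d + h"] t assms e by simp
  ultimately show ?thesis by (simp add: algebra_simps)
qed

lemma convex_on_le_linear:
  fixes f :: "real \<Rightarrow> real"
  assumes "convex_on {0..} f" "f 0 = 0" "x \<ge> 0" "0 \<le> t" "t \<le> 1"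
  shows "f (t * x) \<le> t * f x"
  using convex_onD[OF assms(1), of t 0 x] assms by simp

section \<open>Gaussian moments and tails, and the series of tail bounds\<close>

lemma (in prob_space) gaussian_law_cases:
  assumes Y: "Y \<in> borel_measurable M" and g: "gaussian_law (distr M borel Y)"
  obtains (point) m where "AE \<omega> in M. Y \<omega> = m"
  | (density) m s where "s > 0" "distributed M lborel Y (normal_density m s)"
proof -
  from g consider m where "distr M borel Y = return borel m"
    | m s where "s > 0" "distr M borel Y = density lborel (\<lambda>x. ennreal (normal_density m s x))"
    unfolding gaussian_law_def by blast
  then show thesis
  proof cases
    case 1
    have "AE y in distr M borel Y. y = m" unfolding 1 by (subst AE_return) auto
    then show thesis using Y by (intro point[of m]) (subst (asm) AE_distr_iff, auto)
  next
    case 2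
    have "distr M lborel Y = distr M borel Y" by (intro distr_cong) auto
    then show thesis using 2 Y by (intro density[of s m]) (auto simp: distributed_def)
  qed
qed

lemma (in prob_space) gaussian_law_integrable_power2:
  assumes Y: "Y \<in> borel_measurable M" and g: "gaussian_law (distr M borel Y)"
  shows "integrable M (\<lambda>\<omega>. (Y \<omega>)\<^sup>2)"
  using Y g
proof (cases rule: gaussian_law_cases)
  case (point m)
  have "integrable M (\<lambda>\<omega>. (Y \<omega>)\<^sup>2) \<longleftrightarrow> integrable M (\<lambda>\<omega>. m\<^sup>2)"
    using Y point by (intro integrable_cong_AE) auto
  then show ?thesis by simp
next
  case (density m s)
  \<comment> \<open>The second moment is expanded in powers of \<open>x - m\<close>, since
    integrability is known for moments about the mean.\<close>
  have e: "normal_density m s x * x\<^sup>2 = normal_density m s x * (x - m) ^ 2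
      + 2 * m * (normal_density m s x * (x - m) ^ 1) + m\<^sup>2 * (normal_density m s x * (x - m) ^ 0)"
    for x by (simp add: power2_eq_square algebra_simps)
  have "integrable lborel (\<lambda>x. normal_density m s x * x\<^sup>2)"
    unfolding e using density(1)
    by (intro Bochner_Integration.integrable_add integrable_mult_right integrable_normal_moment)
  then show ?thesis
    using distributed_integrable[OF density(2), of "\<lambda>x. x\<^sup>2"] by simp
qed

text \<open>For \<open>x > y \<ge> 0\<close> one has
  \<open>x\<^sup>2 \<ge> y\<^sup>2 + (x - y)\<^sup>2\<close>. Hence beyond \<open>y\<close> the
  density is at most the desired exponential times a normal density centred at \<open>y\<close>,
  which has mass 1. The variance is only bounded by \<open>v\<close>, so that variables with
  different variances can share one bound.\<close>

lemma (in prob_space) gaussian_tail_le: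
  assumes Y: "Y \<in> borel_measurable M" and g: "gaussian_law (distr M borel Y)"
    and mean: "expectation Y = 0" and var: "expectation (\<lambda>\<omega>. (Y \<omega>)\<^sup>2) \<le> v"
    and v: "v > 0" and y: "y \<ge> 0"
  shows "prob {\<omega> \<in> space M. y < Y \<omega>} \<le> exp (- y\<^sup>2 / (2 * v))"
  using Y g
proof (cases rule: gaussian_law_cases)
  case (point m)
  have "expectation Y = expectation (\<lambda>\<omega>. m)" using Y point by (intro integral_cong_AE) auto
  then have "m = 0" using mean by (simp add: prob_space)
  then have "AE \<omega> in M. \<not> y < Y \<omega>" using point y by auto
  then have "prob {\<omega> \<in> space M. y < Y \<omega>} = prob {}" using Y
    by (intro finite_measure_eq_AE) auto
  then show ?thesis by simp
next
  case (density m s)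
  have m: "m = 0" using normal_distributed_expectation[OF density] mean by simp
  have "variance Y = s\<^sup>2" by (rule normal_distributed_variance[OF density])
  then have s: "s\<^sup>2 \<le> v" using mean var by simp
  let ?C = "exp (- y\<^sup>2 / (2 * s\<^sup>2))"
  have "emeasure M {\<omega> \<in> space M. y < Y \<omega>} = emeasure M (Y -` {y<..} \<inter> space M)"
    by (intro arg_cong[where f="emeasure M"]) auto
  also have "\<dots> = (\<integral>\<^sup>+x. ennreal (normal_density 0 s x) * indicator {y<..} x \<partial>lborel)"
    using distributed_emeasure[OF density(2), of "{y<..}"] m by simp
  also have "\<dots> \<le> (\<integral>\<^sup>+x. ennreal ?C * ennreal (normal_density y s x) \<partial>lborel)"
  proof (intro nn_integral_mono)
    fix x :: real
    have "normal_density 0 s x \<le> ?C * normal_density y s x" if "x > y"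
    proof -
      have "y * (x - y) \<ge> 0" using that y by simp
      then have "y\<^sup>2 + (x - y)\<^sup>2 \<le> x\<^sup>2" by (simp add: power2_eq_square algebra_simps)
      then have "- x\<^sup>2 / (2 * s\<^sup>2) \<le> - y\<^sup>2 / (2 * s\<^sup>2) + - (x - y)\<^sup>2 / (2 * s\<^sup>2)"
        using density(1) by (simp add: field_simps)
      then have "exp (- x\<^sup>2 / (2 * s\<^sup>2)) \<le> ?C * exp (- (x - y)\<^sup>2 / (2 * s\<^sup>2))"
        by (simp flip: exp_add)
      then show ?thesis using density(1) unfolding normal_density_def
        by (simp add: divide_right_mono)
    qed
    then show "ennreal (normal_density 0 s x) * indicator {y<..} x
        \<le> ennreal ?C * ennreal (normal_density y s x)"
      by (auto split: split_indicator simp flip: ennreal_mult)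
  qed
  also have "\<dots> = ennreal ?C * (\<integral>\<^sup>+x. ennreal (normal_density y s x) \<partial>lborel)"
    by (rule nn_integral_cmult) simp
  also have "(\<integral>\<^sup>+x. ennreal (normal_density y s x) \<partial>lborel) = 1"
    using prob_space.emeasure_space_1[OF prob_space_normal_density[OF density(1), of y]]
    by (simp add: emeasure_density)
  finally have "prob {\<omega> \<in> space M. y < Y \<omega>} \<le> ?C"
    unfolding emeasure_eq_measure by simp
  also have "\<dots> \<le> exp (- y\<^sup>2 / (2 * v))"
    using s v density(1) by (auto intro!: divide_left_mono)
  finally show ?thesis .
qed

text \<open>On the unit interval to the right of \<open>y\<close> the density is at least its value
  at \<open>y + 1\<close>. This crude bound loses only factors that vanish on the scale of the
  logarithm divided by the squared level. The point mass is excluded because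
  \<open>v > 0\<close>.\<close>

lemma (in prob_space) gaussian_tail_ge:
  assumes Y: "Y \<in> borel_measurable M" and g: "gaussian_law (distr M borel Y)"
    and mean: "expectation Y = 0" and var: "expectation (\<lambda>\<omega>. (Y \<omega>)\<^sup>2) = v"
    and v: "v > 0" and y: "y \<ge> 0"
  shows "exp (- (y + 1)\<^sup>2 / (2 * v)) / sqrt (2 * pi * v) \<le> prob {\<omega> \<in> space M. y < Y \<omega>}"
  using Y g
proof (cases rule: gaussian_law_cases)
  case (point m)
  have "expectation Y = expectation (\<lambda>\<omega>. m)" using Y point by (intro integral_cong_AE) auto
  then have "m = 0" using mean by (simp add: prob_space)
  then have "expectation (\<lambda>\<omega>. (Y \<omega>)\<^sup>2) = expectation (\<lambda>\<omega>. 0)"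
    using Y point by (intro integral_cong_AE) auto
  then show ?thesis using var v by simp
next
  case (density m s)
  have m: "m = 0" using normal_distributed_expectation[OF density] mean by simp
  have "variance Y = s\<^sup>2" by (rule normal_distributed_variance[OF density])
  then have s: "s\<^sup>2 = v" using mean var by simp
  let ?C = "exp (- (y + 1)\<^sup>2 / (2 * v)) / sqrt (2 * pi * v)"
  have "ennreal ?C = ennreal ?C * emeasure lborel {y<..y + 1}" by simp
  also have "\<dots> = (\<integral>\<^sup>+x. ennreal ?C * indicator {y<..y + 1} x \<partial>lborel)"
    by (simp add: nn_integral_cmult_indicator)
  also have "\<dots> \<le> (\<integral>\<^sup>+x. ennreal (normal_density 0 s x) * indicator {y<..} x \<partial>lborel)"
  proof (intro nn_integral_mono)
    fix x :: real
    have "?C \<le> normal_density 0 s x" if x: "x > y" "x \<le> y + 1"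
    proof -
      have "x\<^sup>2 \<le> (y + 1)\<^sup>2" using x y by (intro power_mono) auto
      then show ?thesis using v unfolding normal_density_def s
        by (auto simp: divide_simps mult_left_mono)
    qed
    then show "ennreal ?C * indicator {y<..y + 1} x \<le> ennreal (normal_density 0 s x) * indicator {y<..} x"
      by (auto split: split_indicator intro!: ennreal_leI)
  qed
  also have "\<dots> = emeasure M (Y -` {y<..} \<inter> space M)"
    using distributed_emeasure[OF density(2), of "{y<..}"] m by simp
  also have "\<dots> = emeasure M {\<omega> \<in> space M. y < Y \<omega>}"
    by (intro arg_cong[where f="emeasure M"]) auto
  finally show ?thesis unfolding emeasure_eq_measure by simp
qed

text \<open>By Bernoulli, \<open>(9 / 8) ^ n \<ge> 1 + n / 8\<close>, so each level gains a factor
  \<open>exp (- \<kappa> / 8) \<le> 1 / 4\<close>. This beats the \<open>2 ^ n\<close> increments of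
  level \<open>n\<close> and leaves a geometric series of ratio 1/2.\<close>

lemma dyadic_series_le:
  fixes \<kappa> :: real
  assumes "exp (- \<kappa> / 8) \<le> 1 / 4" "p \<ge> 0" "\<And>n. 0 \<le> q n"
    and q: "\<And>n. q n \<le> 2 ^ n * (p * exp (- \<kappa> * (9 / 8) ^ n))"
  shows "summable q" "suminf q \<le> 2 * p * exp (- \<kappa>)"
proof -
  have "\<kappa> \<ge> 0"
  proof (rule ccontr)
    assume "\<not> \<kappa> \<ge> 0"
    then have "exp (- \<kappa> / 8) > 1" by (subst one_less_exp_iff) simp
    then show False using assms(1) by linarith
  qed
  have le: "q n \<le> p * exp (- \<kappa>) * (1 / 2) ^ n" for n
  proof -
    have "1 + real n * (1 / 8) \<le> (1 + 1 / 8) ^ n" by (rule Bernoulli_inequality) simp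
    then have "\<kappa> * (1 + real n * (1 / 8)) \<le> \<kappa> * (9 / 8) ^ n" 
      using \<open>\<kappa> \<ge> 0\<close> by (intro mult_left_mono) auto
    then have "exp (- \<kappa> * (9 / 8) ^ n) \<le> exp (- \<kappa> + real n * (- \<kappa> / 8))"
      by (simp add: algebra_simps)
    also have "\<dots> = exp (- \<kappa>) * exp (- \<kappa> / 8) ^ n"
      by (simp only: exp_add exp_of_nat_mult)
    also have "\<dots> \<le> exp (- \<kappa>) * (1 / 4) ^ n"
      using assms(1) by (intro mult_left_mono power_mono) auto
    finally have "2 ^ n * (p * exp (- \<kappa> * (9 / 8) ^ n)) \<le> 2 ^ n * (p * (exp (- \<kappa>) * (1 / 4) ^ n))"
      using assms(2) by (intro mult_left_mono) auto
    also have "\<dots> = p * exp (- \<kappa>) * (2 ^ n * (1 / 4) ^ n)" by (simp only: ac_simps)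
    also have "(2::real) ^ n * (1 / 4) ^ n = (1 / 2) ^ n" by (simp flip: power_mult_distrib)
    finally show ?thesis using q[of n] by linarith
  qed
  have sums: "(\<lambda>n. p * exp (- \<kappa>) * (1 / 2) ^ n) sums (p * exp (- \<kappa>) * 2)"
    using geometric_sums[of "1 / 2 :: real"] by (intro sums_mult) simp
  show *: "summable q"
    by (rule summable_comparison_test[OF _ sums_summable[OF sums]]) (use le assms in auto)
  show "suminf q \<le> 2 * p * exp (- \<kappa>)"
    using suminf_le[OF le * sums_summable[OF sums]] sums_unique[OF sums] by simp
qed

section \<open>The ruin condition for a single continuous path\<close>

text \<open>A negative supremum keeps a margin from 0, which pointwise negativity would not ensure.
  Margins of the form \<open>1 / real (Suc n)\<close> turn the condition into a countable
  union.\<close>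

lemma SUP_ereal_less_0_imp_uniform:
  assumes "(SUP s\<in>I. ereal (f s)) < 0"
  obtains n :: nat where "\<And>s. s \<in> I \<Longrightarrow> f s \<le> - (1 / real (Suc n))"
proof -
  obtain y where y: "(SUP s\<in>I. ereal (f s)) < ereal y" "ereal y < 0"
    using ereal_dense2[OF assms] by blast
  obtain n where n: "inverse (real (Suc n)) < - y" using reals_Archimedean[of "- y"] y by auto
  have "f s \<le> - (1 / real (Suc n))" if "s \<in> I" for s
  proof -
    have "ereal (f s) < ereal y" using y(1) that by (meson SUP_upper le_less_trans)
    then show ?thesis using n by (simp add: inverse_eq_divide)
  qed
  then show thesis by (rule that)
qed

lemma uniform_imp_SUP_ereal_less_0:
  assumes "\<And>s. s \<in> I \<Longrightarrow> f s \<le> - r" "r > 0"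
  shows "(SUP s\<in>I. ereal (f s)) < 0"
proof -
  have "(SUP s\<in>I. ereal (f s)) \<le> ereal (- r)" using assms by (intro SUP_least) simp
  also have "\<dots> < 0" using assms by simp
  finally show ?thesis .
qed

lemma Rats_approx_in_Icc:
  fixes a b x d :: real
  assumes "a < b" "x \<in> {a..b}" "d > 0"
  obtains q where "q \<in> \<rat>" "q \<in> {a..b}" "\<bar>q - x\<bar> < d"
proof -
  have "max a (x - d) < min b (x + d)" using assms by auto
  then obtain q where "q \<in> \<rat>" "max a (x - d) < q" "q < min b (x + d)"
    using Rats_dense_in_real by blast
  then show thesis by (intro that[of q]) auto
qed

text \<open>For continuous paths the ruin event depends only on countably many times, whence its
  measurability up to null sets.\<close>

lemma INF_SUP_less_0_iff_rational:
  fixes f :: "real \<Rightarrow> real"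
  assumes cont: "continuous_on {0..} f" and S: "S > 0" and T: "T > 0"
  shows "(INF t\<in>{0..S}. SUP s\<in>{t..t + T}. ereal (f s)) < 0 \<longleftrightarrow>
    (\<exists>n::nat. \<exists>t\<in>\<rat> \<inter> {0..S}. \<forall>q\<in>\<rat> \<inter> {0..1}. f (t + T * q) \<le> - (1 / real (Suc n)))"
    (is "?L \<longleftrightarrow> ?R")
proof
  assume ?L
  then obtain t where t: "t \<in> {0..S}" "(SUP s\<in>{t..t + T}. ereal (f s)) < 0"
    by (auto simp: INF_less_iff)
  obtain n where n: "\<And>s. s \<in> {t..t + T} \<Longrightarrow> f s \<le> - (1 / real (Suc n))"
    using SUP_ereal_less_0_imp_uniform[OF t(2)] by blast
  define r where "r = 1 / real (Suc n)"
  have r: "r > 0" by (simp add: r_def)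
  have "uniformly_continuous_on {0..S + T} f"
    by (intro compact_uniformly_continuous continuous_on_subset[OF cont]) auto
  then obtain d where d: "d > 0" "\<And>x y. x \<in> {0..S + T} \<Longrightarrow> y \<in> {0..S + T} \<Longrightarrow> \<bar>y - x\<bar> < d \<Longrightarrow> \<bar>f y - f x\<bar> < r / 2"
    unfolding uniformly_continuous_on_def dist_real_def using r by (meson half_gt_zero)
  obtain p where p: "p \<in> \<rat>" "p \<in> {0..S}" "\<bar>p - t\<bar> < d"
    using Rats_approx_in_Icc[OF S t(1) d(1)] by blast
  \<comment> \<open>Moving the window from \<open>t\<close> to the rational start \<open>p\<close>
    costs at most half the margin, and \<open>Suc (2 * n + 1)\<close> is twice
    \<open>Suc n\<close>.\<close>
  have "f (p + T * q) \<le> - (1 / real (Suc (2 * n + 1)))" if "q \<in> {0..1}" for q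
  proof -
    have q: "0 \<le> T * q" "T * q \<le> T" using that T by (auto simp: mult_left_le)
    have "f (t + T * q) \<le> - r" unfolding r_def using q by (intro n) auto
    moreover have "\<bar>f (p + T * q) - f (t + T * q)\<bar> < r / 2"
      using q p t by (intro d) auto
    ultimately have "f (p + T * q) \<le> - (r / 2)" by linarith
    then show ?thesis by (simp add: r_def field_simps)
  qed
  then show ?R using p by blast
next
  assume ?R
  then obtain n t where t: "t \<in> {0..S}"
    and n: "\<And>q. q \<in> \<rat> \<inter> {0..1} \<Longrightarrow> f (t + T * q) \<le> - (1 / real (Suc n))" by blast
  define r where "r = 1 / real (Suc n)"
  \<comment> \<open>The points \<open>t + T * q\<close> with rational \<open>q\<close> are dense in
    the window whatever the value of \<open>T\<close>, so continuity recovers every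
    \<open>s\<close>.\<close>
  have "f s \<le> - r" if s: "s \<in> {t..t + T}" for s
  proof (rule field_le_epsilon)
    fix e :: real assume "e > 0"
    then obtain d where d: "d > 0" "\<And>y. y \<in> {0..} \<Longrightarrow> \<bar>y - s\<bar> < d \<Longrightarrow> \<bar>f y - f s\<bar> < e"
      using cont s t unfolding continuous_on_iff dist_real_def by (metis atLeast_iff atLeastAtMost_iff order_trans)
    have "(s - t) / T \<in> {0..1}" "d / T > 0" using s T d by auto
    then obtain q where q: "q \<in> \<rat>" "q \<in> {0..1}" "\<bar>q - (s - t) / T\<bar> < d / T"
      using Rats_approx_in_Icc[of 0 1 "(s - t) / T" "d / T"] by auto
    have "t + T * q - s = T * (q - (s - t) / T)" using T by (simp add: field_simps)
    then have "\<bar>t + T * q - s\<bar> = T * \<bar>q - (s - t) / T\<bar>" using T by (simp add: abs_mult)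
    also have "\<dots> < d" using q(3) T by (simp add: field_simps)
    finally have "\<bar>f (t + T * q) - f s\<bar> < e" using t q T by (intro d) auto
    moreover have "f (t + T * q) \<le> - r" unfolding r_def using q by (intro n) auto
    ultimately show "f s \<le> - r + e" by linarith
  qed
  then have "(SUP s\<in>{t..t + T}. ereal (f s)) < 0"
    by (rule uniform_imp_SUP_ereal_less_0[where r = r]) (simp_all add: r_def)
  then show ?L using t by (auto simp: INF_less_iff)
qed

section \<open>Moments and tails of the process and its increments\<close>

locale gaussian_stationary_increments = prob_space M
  for M :: "'a measure" and X :: "real \<Rightarrow> 'a \<Rightarrow> real" +
  assumes gaussian: "gaussian_process M X"
    and centered: "centered_process M X"
    and cont_paths: "ae_continuous_paths M X"
    and start: "AE \<omega> in M. X 0 \<omega> = 0"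
    and stationary: "stationary_increments M X"
    and strict_mono_var: "strict_mono_on {0..} (variance_function M X)"
    and convex_var: "convex_on {0..} (variance_function M X)"
begin

abbreviation var where "var \<equiv> variance_function M X"

lemma measurable_X [measurable]: "t \<ge> 0 \<Longrightarrow> X t \<in> borel_measurable M"
  using gaussian unfolding gaussian_process_def by blast

lemma integrable_X: "t \<ge> 0 \<Longrightarrow> integrable M (X t)"
  and expectation_X: "t \<ge> 0 \<Longrightarrow> expectation (X t) = 0"
  using centered unfolding centered_process_def by auto

lemma gaussian_sum:
  assumes "finite I" "I \<subseteq> {0..}"
  shows "gaussian_law (distr M borel (\<lambda>\<omega>. \<Sum>t\<in>I. a t * X t \<omega>))"
  using gaussian assms unfolding gaussian_process_def by blast

lemma gaussian_comb3:
  assumes "r \<ge> 0" "s \<ge> 0" "t \<ge> 0"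
  shows "gaussian_law (distr M borel (\<lambda>\<omega>. x * X r \<omega> + y * X s \<omega> + z * X t \<omega>))"
proof -
  \<comment> \<open>The coefficients add up when some of the times coincide, in which case the index
    set collapses.\<close>
  let ?a = "\<lambda>i. (if i = r then x else 0) + (if i = s then y else 0) + (if i = t then z else 0)"
  have "(\<lambda>\<omega>. x * X r \<omega> + y * X s \<omega> + z * X t \<omega>) = (\<lambda>\<omega>. \<Sum>i\<in>{r, s, t}. ?a i * X i \<omega>)"
    by (simp add: distrib_right sum.distrib if_distrib[of "\<lambda>c. c * _"] sum.delta cong: if_cong)
  then show ?thesis using gaussian_sum[of "{r, s, t}" ?a] assms by simp
qed

lemma gaussian_X: "t \<ge> 0 \<Longrightarrow> gaussian_law (distr M borel (X t))"
  using gaussian_comb3[of t t t 1 0 0] by simp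

lemma gaussian_increment:
  "s \<ge> 0 \<Longrightarrow> t \<ge> 0 \<Longrightarrow> gaussian_law (distr M borel (\<lambda>\<omega>. X t \<omega> - X s \<omega>))"
  using gaussian_comb3[of t s s 1 "-1" 0] by simp

lemma integrable_X_power2: "t \<ge> 0 \<Longrightarrow> integrable M (\<lambda>\<omega>. (X t \<omega>)\<^sup>2)"
  by (intro gaussian_law_integrable_power2 gaussian_X) simp_all

lemma integrable_increment_power2:
  "s \<ge> 0 \<Longrightarrow> t \<ge> 0 \<Longrightarrow> integrable M (\<lambda>\<omega>. (X t \<omega> - X s \<omega>)\<^sup>2)"
  by (intro gaussian_law_integrable_power2 gaussian_increment) simp_all

lemma second_moment_X: "t \<ge> 0 \<Longrightarrow> expectation (\<lambda>\<omega>. (X t \<omega>)\<^sup>2) = var t"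
  by (simp add: variance_function_def expectation_X)

lemma var_0: "var 0 = 0"
proof -
  have "expectation (\<lambda>\<omega>. (X 0 \<omega>)\<^sup>2) = expectation (\<lambda>\<omega>. 0)"
    using start by (intro integral_cong_AE) auto
  then show ?thesis using second_moment_X[of 0] by simp
qed

lemma var_less: "0 \<le> s \<Longrightarrow> s < t \<Longrightarrow> var s < var t"
  using strict_mono_var by (auto simp: strict_mono_on_def)

lemma var_mono: "0 \<le> s \<Longrightarrow> s \<le> t \<Longrightarrow> var s \<le> var t"
  using var_less[of s t] by (cases "s = t") auto

lemma var_pos: "t > 0 \<Longrightarrow> var t > 0"
  using var_less[of 0 t] var_0 by simp

lemma distr_increment:
  assumes "s \<ge> 0" "h \<ge> 0"
  shows "distr M borel (\<lambda>\<omega>. X (s + h) \<omega> - X s \<omega>) = distr M borel (\<lambda>\<omega>. X h \<omega> - X 0 \<omega>)"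
proof -
  \<comment> \<open>Stationarity speaks of laws on product spaces; evaluating the coordinate of a
    one-point index set turns them into laws on the reals.\<close>
  have *: "distr (distr M (Pi\<^sub>M {h} (\<lambda>_. borel)) (\<lambda>\<omega>. \<lambda>t\<in>{h}. f t \<omega>)) borel (\<lambda>g. g h)
      = distr M borel (f h)" if "f h \<in> borel_measurable M" for f :: "real \<Rightarrow> 'a \<Rightarrow> real"
  proof -
    have m: "(\<lambda>\<omega>. \<lambda>t\<in>{h}. f t \<omega>) \<in> M \<rightarrow>\<^sub>M Pi\<^sub>M {h} (\<lambda>_. borel)"
      using that by (intro measurable_restrict) auto
    show ?thesis by (subst distr_distr[OF _ m]) (auto simp: o_def)
  qed
  have "distr M (Pi\<^sub>M {h} (\<lambda>_. borel)) (\<lambda>\<omega>. \<lambda>t\<in>{h}. X (s + t) \<omega> - X s \<omega>) =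
      distr M (Pi\<^sub>M {h} (\<lambda>_. borel)) (\<lambda>\<omega>. \<lambda>t\<in>{h}. X t \<omega> - X 0 \<omega>)"
    using stationary assms unfolding stationary_increments_def by simp
  then show ?thesis
    using *[of "\<lambda>t \<omega>. X (s + t) \<omega> - X s \<omega>"] *[of "\<lambda>t \<omega>. X t \<omega> - X 0 \<omega>"] assms by simp
qed

lemma second_moment_increment:
  assumes "s \<ge> 0" "h \<ge> 0"
  shows "expectation (\<lambda>\<omega>. (X (s + h) \<omega> - X s \<omega>)\<^sup>2) = var h"
proof -
  have "expectation (\<lambda>\<omega>. (X (s + h) \<omega> - X s \<omega>)\<^sup>2)
      = (\<integral>y. y\<^sup>2 \<partial>distr M borel (\<lambda>\<omega>. X (s + h) \<omega> - X s \<omega>))"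
    using assms by (subst integral_distr) auto
  also have "\<dots> = expectation (\<lambda>\<omega>. (X h \<omega> - X 0 \<omega>)\<^sup>2)"
    unfolding distr_increment[OF assms] using assms by (subst integral_distr) auto
  also have "\<dots> = expectation (\<lambda>\<omega>. (X h \<omega>)\<^sup>2)"
    using start assms by (intro integral_cong_AE) auto
  finally show ?thesis using second_moment_X assms by simp
qed

lemma increment_tail_le:
  assumes "e = 1 \<or> e = - 1" "s \<ge> 0" "h > 0" "b \<ge> 0"
  shows "prob {\<omega> \<in> space M. b < e * (X (s + h) \<omega> - X s \<omega>)} \<le> exp (- b\<^sup>2 / (2 * var h))"
proof (rule gaussian_tail_le)
  have "(\<lambda>\<omega>. e * (X (s + h) \<omega> - X s \<omega>)) = (\<lambda>\<omega>. e * X (s + h) \<omega> + (- e) * X s \<omega> + 0 * X s \<omega>)"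
    by (simp add: algebra_simps)
  then show "gaussian_law (distr M borel (\<lambda>\<omega>. e * (X (s + h) \<omega> - X s \<omega>)))"
    using gaussian_comb3[of "s + h" s s e "- e" 0] assms by simp
  show "expectation (\<lambda>\<omega>. e * (X (s + h) \<omega> - X s \<omega>)) = 0"
    using assms by (simp add: integrable_X expectation_X)
  have "(\<lambda>\<omega>. (e * (X (s + h) \<omega> - X s \<omega>))\<^sup>2) = (\<lambda>\<omega>. (X (s + h) \<omega> - X s \<omega>)\<^sup>2)"
    using assms(1) by (auto simp: power2_commute)
  then show "expectation (\<lambda>\<omega>. (e * (X (s + h) \<omega> - X s \<omega>))\<^sup>2) \<le> var h"
    using assms second_moment_increment[of s h] by simp
qed (use assms var_pos in auto)

text \<open>Convexity of the variance makes \<open>X S\<close> and the increment nonnegatively correlated, so the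
  optimal linear combination yields the same exponent as for an independent pair.\<close>

lemma joint_tail_le:
  assumes "S > 0" "s \<ge> S" "h > 0" "a > 0" "b \<ge> 0"
  shows "prob {\<omega> \<in> space M. a < X S \<omega> \<and> b < - (X (s + h) \<omega> - X s \<omega>)}
    \<le> exp (- a\<^sup>2 / (2 * var S)) * exp (- b\<^sup>2 / (2 * var h))"
proof -
  \<comment> \<open>These weights are the optimal ones for an independent pair: the threshold
    \<open>\<alpha> * a + \<beta> * b\<close> and the variance of the combination would then both
    equal \<open>y\<close>, so that the Gaussian tail is \<open>exp (- y / 2)\<close>.\<close>
  define \<alpha> where "\<alpha> = a / var S"
  define \<beta> where "\<beta> = b / var h"
  define y where "y = a\<^sup>2 / var S + b\<^sup>2 / var h"
  define Y where "Y \<omega> = \<alpha> * X S \<omega> + (- \<beta>) * X (s + h) \<omega> + \<beta> * X s \<omega>" for \<omega>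
  note p = var_pos[OF \<open>S > 0\<close>] var_pos[OF \<open>h > 0\<close>]
  have pos: "s \<ge> 0" "\<alpha> > 0" "\<beta> \<ge> 0" using assms p by (auto simp: \<alpha>_def \<beta>_def)
  have y: "y > 0" using assms p by (simp add: y_def add_pos_nonneg)
  have y_eq: "\<alpha> * a + \<beta> * b = y" "\<alpha>\<^sup>2 * var S + \<beta>\<^sup>2 * var h = y"
    using p by (auto simp: y_def \<alpha>_def \<beta>_def power2_eq_square)
  have [measurable]: "Y \<in> borel_measurable M" unfolding Y_def using assms pos by simp
  \<comment> \<open>Polarization: twice the product of \<open>X S\<close> and the increment is
    written through squares, because the second moments of increments are what stationarity
    supplies.\<close>
  have Y2: "(Y \<omega>)\<^sup>2 = \<alpha>\<^sup>2 * (X S \<omega>)\<^sup>2 + \<beta>\<^sup>2 * (X (s + h) \<omega> - X s \<omega>)\<^sup>2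
      - \<alpha> * \<beta> * ((X (s + h) \<omega>)\<^sup>2 - (X s \<omega>)\<^sup>2 - (X (s + h) \<omega> - X S \<omega>)\<^sup>2 + (X s \<omega> - X S \<omega>)\<^sup>2)" for \<omega>
    unfolding Y_def by (simp add: power2_eq_square algebra_simps)
  have incr: "expectation (\<lambda>\<omega>. (X (s + h) \<omega> - X S \<omega>)\<^sup>2) = var (s + h - S)"
    "expectation (\<lambda>\<omega>. (X s \<omega> - X S \<omega>)\<^sup>2) = var (s - S)"
    using second_moment_increment[of S "s + h - S"] second_moment_increment[of S "s - S"] assms
    by auto
  have "expectation (\<lambda>\<omega>. (Y \<omega>)\<^sup>2) = \<alpha>\<^sup>2 * var S + \<beta>\<^sup>2 * var h
      - \<alpha> * \<beta> * (var (s + h) - var s - var (s + h - S) + var (s - S))"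
    unfolding Y2 using assms pos
    by (simp add: integrable_X_power2 integrable_increment_power2 second_moment_X
        second_moment_increment incr)
  \<comment> \<open>This is twice the covariance of \<open>X S\<close> with the increment. It is
    nonnegative because a convex \<open>var\<close> grows more over length \<open>h\<close> from
    \<open>s\<close> than from \<open>s - S\<close>.\<close>
  moreover have "0 \<le> var (s + h) - var s - var (s + h - S) + var (s - S)"
    using convex_on_increment_mono[OF convex_var, of "s - S" h S] assms by (simp add: algebra_simps)
  ultimately have "expectation (\<lambda>\<omega>. (Y \<omega>)\<^sup>2) \<le> y" using y_eq(2) pos by simp
  moreover have "expectation Y = 0" unfolding Y_def using assms pos
    by (simp add: integrable_X expectation_X)
  moreover have "gaussian_law (distr M borel Y)"
    unfolding Y_def using assms pos by (intro gaussian_comb3) auto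
  ultimately have "prob {\<omega> \<in> space M. y < Y \<omega>} \<le> exp (- y\<^sup>2 / (2 * y))"
    using y by (intro gaussian_tail_le) auto
  also have "- y\<^sup>2 / (2 * y) = - (y / 2)" using y by (simp add: power2_eq_square)
  also have "\<dots> = - a\<^sup>2 / (2 * var S) + - b\<^sup>2 / (2 * var h)"
    by (simp add: y_def add_divide_distrib)
  finally have "prob {\<omega> \<in> space M. y < Y \<omega>} \<le> exp (- a\<^sup>2 / (2 * var S)) * exp (- b\<^sup>2 / (2 * var h))"
    by (simp only: exp_add)
  moreover have "y < Y \<omega>" if "a < X S \<omega>" "b < - (X (s + h) \<omega> - X s \<omega>)" for \<omega>
  proof -
    have "\<alpha> * a < \<alpha> * X S \<omega>" using that pos by simp
    moreover have "\<beta> * b \<le> \<beta> * - (X (s + h) \<omega> - X s \<omega>)" using that pos by (intro mult_left_mono) auto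
    ultimately show ?thesis unfolding Y_def y_eq(1)[symmetric] by (simp add: algebra_simps)
  qed
  then have "prob {\<omega> \<in> space M. a < X S \<omega> \<and> b < - (X (s + h) \<omega> - X s \<omega>)}
      \<le> prob {\<omega> \<in> space M. y < Y \<omega>}"
    by (intro finite_measure_mono) auto
  ultimately show ?thesis by linarith
qed

section \<open>Chaining along the paths of the process\<close>

text \<open>A union bound over all dyadic increments. The event \<open>A\<close>, the factor
  \<open>p\<close> and the sign \<open>e\<close> let one lemma serve twice: upward moves on the
  whole space with \<open>p = 1\<close>, and downward moves after \<open>S\<close> on a rare event
  for \<open>X S\<close>, whose small probability bound is kept as the factor
  \<open>p\<close>.\<close>

lemma increment_chaining:
  assumes "e = 1 \<or> e = - 1" "s \<ge> 0" "L > 0" "d > 0" "p \<ge> 0" "A \<in> events"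
    and tail: "\<And>t h b. t \<ge> s \<Longrightarrow> h > 0 \<Longrightarrow> b \<ge> 0 \<Longrightarrow>
      prob {\<omega> \<in> A. b < e * (X (t + h) \<omega> - X t \<omega>)} \<le> p * exp (- b\<^sup>2 / (2 * var h))"
    and \<kappa>: "\<kappa> = d\<^sup>2 / (16 * var L)" "exp (- \<kappa> / 8) \<le> 1 / 4"
  obtains Bad where "Bad \<in> events" "prob Bad \<le> 2 * p * exp (- \<kappa>)"
    "\<And>\<omega> t. \<omega> \<in> A - Bad \<Longrightarrow> continuous_on {0..} (\<lambda>t. X t \<omega>) \<Longrightarrow> t \<in> {s..s + L} \<Longrightarrow>
      e * X t \<omega> \<le> e * X s \<omega> + d"
proof -
  \<comment> \<open>These allowances sum to \<open>d\<close>. Level \<open>n\<close> has spacing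
    \<open>h n\<close>, whose variance is at most \<open>var L / 2 ^ Suc n\<close> by convexity, so
    its exponent is at least \<open>\<kappa> * (9 / 8) ^ n\<close>: the ratio \<open>3 / 4\<close>
    is large enough that its square times 2 exceeds 1.\<close>
  define b where "b n = d / 4 * (3 / 4) ^ n" for n :: nat
  define h where "h n = L / 2 ^ Suc n" for n
  define G where "G n k = {\<omega> \<in> A. b n < e * (X (s + real (2 * k) * h n + h n) \<omega> - X (s + real (2 * k) * h n) \<omega>)}"
    for n k :: nat
  define B where "B n = (\<Union>k<2 ^ n. G n k)" for n :: nat
  have h: "h n > 0" for n using \<open>L > 0\<close> by (simp add: h_def)
  have b_pos: "b n \<ge> 0" for n using \<open>d > 0\<close> by (simp add: b_def)
  have b_sums: "b sums d"
    using sums_mult[OF geometric_sums[of "3 / 4 :: real"], of "d / 4"] by (simp add: b_def[abs_def])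
  have G_meas: "G n k \<in> events" for n k
  proof -
    have *: "0 \<le> s + real (2 * k) * h n" using h[of n] \<open>s \<ge> 0\<close> by simp
    then have "X (s + real (2 * k) * h n) \<in> borel_measurable M"
      "X (s + real (2 * k) * h n + h n) \<in> borel_measurable M" using h[of n] by auto
    then have "{\<omega> \<in> space M. b n < e * (X (s + real (2 * k) * h n + h n) \<omega> - X (s + real (2 * k) * h n) \<omega>)} \<in> events"
      by measurable
    then have "A \<inter> {\<omega> \<in> space M. b n < e * (X (s + real (2 * k) * h n + h n) \<omega> - X (s + real (2 * k) * h n) \<omega>)} \<in> events"
      using \<open>A \<in> events\<close> by blast
    also have "A \<inter> {\<omega> \<in> space M. b n < e * (X (s + real (2 * k) * h n + h n) \<omega> - X (s + real (2 * k) * h n) \<omega>)} = G n k"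
      using sets.sets_into_space[OF \<open>A \<in> events\<close>] by (auto simp: G_def)
    finally show ?thesis .
  qed
  have B_meas: "B n \<in> events" for n unfolding B_def using G_meas by auto
  have G_prob: "prob (G n k) \<le> p * exp (- \<kappa> * (9 / 8) ^ n)" for n k
  proof -
    have v: "0 < var (h n)" "0 < var L" using h[of n] \<open>L > 0\<close> by (auto intro: var_pos)
    have "var ((1 / 2 ^ Suc n) * L) \<le> 1 / 2 ^ Suc n * var L"
      using convex_var var_0 \<open>L > 0\<close> by (intro convex_on_le_linear) (auto simp del: power_Suc)
    then have "var (h n) \<le> var L / 2 ^ Suc n" by (simp add: h_def)
    then have "(b n)\<^sup>2 / (2 * (var L / 2 ^ Suc n)) \<le> (b n)\<^sup>2 / (2 * var (h n))"
      using v by (intro divide_left_mono) auto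
    moreover have "(b n)\<^sup>2 / (2 * (var L / 2 ^ Suc n)) = \<kappa> * (((3 / 4)\<^sup>2) ^ n * 2 ^ n)"
    proof -
      have "((3 / 4 :: real) ^ n)\<^sup>2 = ((3 / 4)\<^sup>2) ^ n" by (metis power_mult mult.commute)
      then have "(b n)\<^sup>2 = (d / 4)\<^sup>2 * ((3 / 4)\<^sup>2) ^ n" by (simp only: b_def power_mult_distrib)
      moreover have "(d / 4)\<^sup>2 * c / (2 * (var L / 2 ^ Suc n)) = \<kappa> * (c * 2 ^ n)" for c
        using v by (simp add: \<kappa>(1) power2_eq_square field_simps)
      ultimately show ?thesis by (simp only:)
    qed
    moreover have "((3 / 4 :: real)\<^sup>2) ^ n * 2 ^ n = (9 / 8) ^ n"
      by (subst power_mult_distrib[symmetric]) (simp add: power2_eq_square)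
    ultimately have "\<kappa> * (9 / 8) ^ n \<le> (b n)\<^sup>2 / (2 * var (h n))" by simp
    then have "p * exp (- (b n)\<^sup>2 / (2 * var (h n))) \<le> p * exp (- \<kappa> * (9 / 8) ^ n)"
      using \<open>p \<ge> 0\<close> by (intro mult_left_mono) auto
    moreover have "prob (G n k) \<le> p * exp (- (b n)\<^sup>2 / (2 * var (h n)))"
      unfolding G_def using h[of n] b_pos[of n] by (intro tail) auto
    ultimately show ?thesis by linarith
  qed
  have B_prob: "prob (B n) \<le> 2 ^ n * (p * exp (- \<kappa> * (9 / 8) ^ n))" for n
  proof -
    have "prob (B n) \<le> (\<Sum>k<2 ^ n. prob (G n k))"
      unfolding B_def using G_meas by (intro finite_measure_subadditive_finite) auto
    also have "\<dots> \<le> (\<Sum>k<(2 ^ n :: nat). p * exp (- \<kappa> * (9 / 8) ^ n))"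
      by (intro sum_mono G_prob)
    finally show ?thesis by simp
  qed
  note series = dyadic_series_le[OF \<kappa>(2) \<open>p \<ge> 0\<close> measure_nonneg B_prob]
  show thesis
  proof (rule that[of "\<Union>n. B n"])
    show "(\<Union>n. B n) \<in> events" using B_meas by auto
    have "prob (\<Union>n. B n) \<le> (\<Sum>n. prob (B n))"
      using B_meas series(1) by (intro finite_measure_subadditive_countably) auto
    then show "prob (\<Union>n. B n) \<le> 2 * p * exp (- \<kappa>)" using series(2) by linarith
  next
    fix \<omega> t assume \<omega>: "\<omega> \<in> A - (\<Union>n. B n)" and cont: "continuous_on {0..} (\<lambda>t. X t \<omega>)"
      and t: "t \<in> {s..s + L}"
    show "e * X t \<omega> \<le> e * X s \<omega> + d"
    proof (rule dyadic_chaining_bound[of s L "\<lambda>t. e * X t \<omega>" b])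
      show "continuous_on {s..s + L} (\<lambda>t. e * X t \<omega>)"
        using \<open>s \<ge> 0\<close> by (intro continuous_intros continuous_on_subset[OF cont]) auto
      fix n k :: nat assume "k < 2 ^ n"
      then have "\<omega> \<notin> G n k" using \<omega> by (auto simp: B_def)
      then show "e * X (s + real (2 * k) * (L / 2 ^ Suc n) + L / 2 ^ Suc n) \<omega>
          \<le> e * X (s + real (2 * k) * (L / 2 ^ Suc n)) \<omega> + b n"
        using \<omega> by (simp add: G_def h_def[symmetric] not_less algebra_simps del: power_Suc)
    qed (use b_pos b_sums t \<open>L > 0\<close> in auto)
  qed
qed

section \<open>Measurability of the ruin event and bounds at a fixed level\<close>

definition ruin_event :: "real \<Rightarrow> real \<Rightarrow> real \<Rightarrow> real \<Rightarrow> 'a set" where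
  "ruin_event c S u T =
    {\<omega> \<in> space M. (INF t\<in>{0..S}. SUP s\<in>{t..t + T}. ereal (risk_process X c u s \<omega>)) < 0}"

lemma AE_cont: "AE \<omega> in M. continuous_on {0..} (\<lambda>t. X t \<omega>)"
  using cont_paths by (simp add: ae_continuous_paths_def)

text \<open>The event agrees with a countable combination of measurable events except on
  discontinuous paths, a null set. The lower bound relies on this: there the ruin event is the
  larger set, and monotonicity of the measure asks for its measurability.\<close>

lemma sets_completion_ruin_event:
  assumes S: "S > 0" and T: "T > 0"
  shows "ruin_event c S u T \<in> sets (completion M)"
proof -
  define R where "R = {\<omega> \<in> space M. \<exists>n::nat. \<exists>t\<in>\<rat> \<inter> {0..S}. \<forall>q\<in>\<rat> \<inter> {0..1}.
    risk_process X c u (t + T * q) \<omega> \<le> - (1 / real (Suc n))}"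
  have R_eq: "R = (\<Union>n::nat. \<Union>t\<in>\<rat> \<inter> {0..S}. \<Inter>q\<in>\<rat> \<inter> {0..1}.
      {\<omega> \<in> space M. risk_process X c u (t + T * q) \<omega> \<le> - (1 / real (Suc n))})"
  proof -
    have "0 \<in> \<rat> \<inter> {0..1 :: real}" by simp
    then show ?thesis unfolding R_def by blast
  qed
  have "{\<omega> \<in> space M. risk_process X c u (t + T * q) \<omega> \<le> r} \<in> events"
    if "t \<ge> 0" "q \<ge> 0" for t q r
  proof -
    have "0 \<le> t + T * q" using that T by simp
    then show ?thesis unfolding risk_process_def by simp
  qed
  moreover have "0 \<in> \<rat> \<inter> {0..1 :: real}" "countable (\<rat> \<inter> {0..1 :: real})" "countable (\<rat> \<inter> {0..S})"
    by (auto simp: countable_rat)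
  ultimately have R: "R \<in> events"
    unfolding R_eq by (intro sets.countable_UN'' sets.countable_INT' countableI_type) auto
  have "AE \<omega> in M. \<omega> \<in> R \<longleftrightarrow> \<omega> \<in> ruin_event c S u T"
    using AE_cont
  proof (eventually_elim)
    fix \<omega> assume "continuous_on {0..} (\<lambda>t. X t \<omega>)"
    then have "continuous_on {0..} (\<lambda>t. risk_process X c u t \<omega>)"
      unfolding risk_process_def by (intro continuous_intros)
    from INF_SUP_less_0_iff_rational[OF this S T]
    show "\<omega> \<in> R \<longleftrightarrow> \<omega> \<in> ruin_event c S u T" by (simp add: R_def ruin_event_def)
  qed
  then have "AE \<omega> in completion M. \<omega> \<in> R \<longleftrightarrow> \<omega> \<in> ruin_event c S u T"
    by (rule AE_completion)
  then show ?thesis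
    by (rule completion.in_sets_AE) (use R in \<open>simp_all add: ruin_event_def\<close>)
qed

text \<open>Cut \<open>[0, S]\<close> into \<open>N\<close> equal intervals. If \<open>X\<close>
  exceeds \<open>u\<close> somewhere in one of them, then either its value at the left endpoint
  exceeds \<open>u - d\<close>, or the path rises by more than \<open>d\<close> from there. The
  first event is bounded by the largest variance \<open>var S\<close>, the second by
  chaining.\<close>

lemma ruin_prob_le:
  assumes S: "S > 0" and c: "c > 0" and T: "T > 0" and N: "N > (0 :: nat)"
    and d: "0 < d" "d \<le> u"
    and \<kappa>: "\<kappa> = d\<^sup>2 / (16 * var (S / real N))" "exp (- \<kappa> / 8) \<le> 1 / 4"
  shows "measure (completion M) (ruin_event c S u T)
    \<le> real N * (exp (- (u - d)\<^sup>2 / (2 * var S)) + 2 * exp (- \<kappa>))"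
proof -
  define L where "L = S / real N"
  define s where "s i = real i * L" for i
  have L: "L > 0" using S N by (simp add: L_def)
  have s: "s i \<ge> 0" for i using L by (simp add: s_def)
  have s_le: "s i \<le> S" if "i < N" for i
  proof -
    have "real i * L \<le> real N * L" using that L by (intro mult_right_mono) auto
    then show ?thesis using N by (simp add: s_def L_def)
  qed
  \<comment> \<open>Collects what chaining yields on one interval, so that a bad set can be chosen
    for every \<open>i\<close> at once.\<close>
  define good where "good i Bad \<longleftrightarrow> Bad \<in> events \<and> prob Bad \<le> 2 * exp (- \<kappa>) \<and>
      (\<forall>\<omega>\<in>space M - Bad. continuous_on {0..} (\<lambda>t. X t \<omega>) \<longrightarrow>
        (\<forall>t\<in>{s i..s i + L}. X t \<omega> \<le> X (s i) \<omega> + d))" for i Bad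
  have "\<exists>Bad. good i Bad" for i
  proof -
    have tail: "prob {\<omega> \<in> space M. b < 1 * (X (t + h) \<omega> - X t \<omega>)} \<le> 1 * exp (- b\<^sup>2 / (2 * var h))"
      if "t \<ge> s i" "h > 0" "b \<ge> 0" for t h b
      using increment_tail_le[of 1 t h b] that s[of i] by auto
    show ?thesis
    proof (rule increment_chaining[of 1 "s i" L d 1 "space M" \<kappa>,
          OF _ s L d(1) _ _ tail \<kappa>(1)[folded L_def] \<kappa>(2)])
      fix Bad assume "Bad \<in> events" "prob Bad \<le> 2 * 1 * exp (- \<kappa>)"
        and "\<And>\<omega> t. \<omega> \<in> space M - Bad \<Longrightarrow> continuous_on {0..} (\<lambda>t. X t \<omega>) \<Longrightarrow>
          t \<in> {s i..s i + L} \<Longrightarrow> 1 * X t \<omega> \<le> 1 * X (s i) \<omega> + d"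
      then show ?thesis unfolding good_def by (intro exI[of _ Bad]) simp
    qed simp_all
  qed
  then obtain Bad where "\<And>i. good i (Bad i)" by metis
  then have Bad: "\<And>i. Bad i \<in> events" "\<And>i. prob (Bad i) \<le> 2 * exp (- \<kappa>)"
    "\<And>i \<omega> t. \<omega> \<in> space M - Bad i \<Longrightarrow> continuous_on {0..} (\<lambda>t. X t \<omega>) \<Longrightarrow> t \<in> {s i..s i + L} \<Longrightarrow>
        X t \<omega> \<le> X (s i) \<omega> + d" unfolding good_def by blast+
  define H where "H i = {\<omega> \<in> space M. u - d < X (s i) \<omega>}" for i
  have H: "H i \<in> events" for i unfolding H_def using s[of i] by simp
  have H_prob: "prob (H i) \<le> exp (- (u - d)\<^sup>2 / (2 * var S))" if "i < N" for i
    unfolding H_def using s[of i] s_le[OF that] d S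
    by (intro gaussian_tail_le gaussian_X) (auto simp: expectation_X second_moment_X var_pos intro: var_mono)
  define U where "U = (\<Union>i<N. H i \<union> Bad i)"
  have U: "U \<in> events" unfolding U_def using H Bad(1) by auto
  have "AE \<omega> in completion M. \<omega> \<in> ruin_event c S u T \<longrightarrow> \<omega> \<in> U"
    unfolding AE_completion_iff using AE_cont
  proof (eventually_elim, intro impI)
    fix \<omega> assume cont: "continuous_on {0..} (\<lambda>t. X t \<omega>)" and \<omega>: "\<omega> \<in> ruin_event c S u T"
    then obtain t where t: "t \<in> {0..S}" "(SUP s\<in>{t..t + T}. ereal (risk_process X c u s \<omega>)) < 0"
      and sp: "\<omega> \<in> space M" by (auto simp: ruin_event_def INF_less_iff)
    \<comment> \<open>The window contains its starting time \<open>t\<close>, so Parisian ruin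
      implies a negative risk process at \<open>t\<close>; the drift only helps.\<close>
    have "ereal (risk_process X c u t \<omega>) \<le> (SUP s\<in>{t..t + T}. ereal (risk_process X c u s \<omega>))"
      using T by (intro SUP_upper) auto
    then have "ereal (risk_process X c u t \<omega>) < 0" using t(2) by (rule le_less_trans)
    moreover have "c * t \<ge> 0" using c t by simp
    ultimately have X: "u < X t \<omega>" by (simp add: risk_process_def)
    have "\<exists>i<N. t \<in> {s i..s i + L}"
    \<comment> \<open>The right end belongs to the last interval, while the floor used below would
      give the index \<open>N\<close>.\<close>
    proof (cases "t = S")
      case True
      have "s (N - 1) + L = real N * L" using N by (simp add: s_def of_nat_diff algebra_simps)
      also have "\<dots> = S" using N by (simp add: L_def)
      finally show ?thesis using True N L by (intro exI[of _ "N - 1"]) auto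
    next
      case False
      define i where "i = nat \<lfloor>t / L\<rfloor>"
      have tL: "0 \<le> t / L" using t L by simp
      have i: "real i \<le> t / L" "t / L < real i + 1" using tL unfolding i_def by linarith+
      have "t / L < S / L" using t False L by (simp add: divide_strict_right_mono)
      also have "S / L = real N" using S N by (simp add: L_def)
      finally have "i < N" using i by linarith
      moreover have "t \<in> {s i..s i + L}" using i L by (simp add: s_def field_simps)
      ultimately show ?thesis by blast
    qed
    then obtain i where i: "i < N" "t \<in> {s i..s i + L}" by blast
    have "\<omega> \<in> H i \<union> Bad i"
      using Bad(3)[OF _ cont i(2)] X sp by (force simp: H_def)
    then show "\<omega> \<in> U" using i by (auto simp: U_def)
  qed
  then have "measure (completion M) (ruin_event c S u T) \<le> measure (completion M) U"
    unfolding measure_def using U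
    by (intro enn2real_mono emeasure_mono_AE) (auto simp: emeasure_eq_measure less_top[symmetric])
  also have "\<dots> = prob U" using U by simp
  also have "\<dots> \<le> (\<Sum>i<N. prob (H i \<union> Bad i))"
    unfolding U_def using H Bad(1) by (intro finite_measure_subadditive_finite) auto
  also have "\<dots> \<le> (\<Sum>i<N. exp (- (u - d)\<^sup>2 / (2 * var S)) + 2 * exp (- \<kappa>))"
  proof (intro sum_mono)
    fix i assume "i \<in> {..<N}"
    then have "prob (H i) + prob (Bad i) \<le> exp (- (u - d)\<^sup>2 / (2 * var S)) + 2 * exp (- \<kappa>)"
      using H_prob[of i] Bad(2)[of i] by simp
    then show "prob (H i \<union> Bad i) \<le> exp (- (u - d)\<^sup>2 / (2 * var S)) + 2 * exp (- \<kappa>)"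
      using measure_Un_le[OF H[of i] Bad(1)[of i]] by linarith
  qed
  finally show ?thesis by simp
qed

text \<open>Ruin is produced by the last admissible window, the one starting at \<open>S\<close>. If
  \<open>X S > a\<close> and the path drops by at most \<open>d\<close> over the next
  \<open>L\<close> time units, the choice of \<open>a\<close> keeps the risk process below
  \<open>-1\<close> throughout, which makes the supremum strictly negative. The exceptional set is
  taken inside \<open>X S > a\<close>, so its bound is comparable to the main term apart from the
  extra factor \<open>exp (- \<kappa>)\<close>.\<close>

lemma ruin_prob_ge:
  assumes S: "S > 0" and c: "c > 0" and T: "0 < T" "T \<le> L"
    and d: "0 < d" and u: "u \<ge> 0"
    and a: "a = u + c * (S + L) + 1 + d"
    and \<kappa>: "\<kappa> = d\<^sup>2 / (16 * var L)" "exp (- \<kappa> / 8) \<le> 1 / 4"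
  shows "exp (- (a + 1)\<^sup>2 / (2 * var S)) / sqrt (2 * pi * var S)
      - 2 * exp (- a\<^sup>2 / (2 * var S)) * exp (- \<kappa>)
    \<le> measure (completion M) (ruin_event c S u T)"
proof -
  have L: "L > 0" using T by simp
  have a_pos: "a > 0" using assms L by (simp add: add_nonneg_pos)
  define A where "A = {\<omega> \<in> space M. a < X S \<omega>}"
  have A: "A \<in> events" unfolding A_def using S by simp
  have tail: "prob {\<omega> \<in> A. b < - 1 * (X (t + h) \<omega> - X t \<omega>)}
      \<le> exp (- a\<^sup>2 / (2 * var S)) * exp (- b\<^sup>2 / (2 * var h))"
    if "t \<ge> S" "h > 0" "b \<ge> 0" for t h b
    using joint_tail_le[OF S that(1,2) a_pos that(3)] by (simp add: A_def)
  obtain Bad where Bad: "Bad \<in> events" "prob Bad \<le> 2 * exp (- a\<^sup>2 / (2 * var S)) * exp (- \<kappa>)"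
    "\<And>\<omega> t. \<omega> \<in> A - Bad \<Longrightarrow> continuous_on {0..} (\<lambda>t. X t \<omega>) \<Longrightarrow> t \<in> {S..S + L} \<Longrightarrow>
      - 1 * X t \<omega> \<le> - 1 * X S \<omega> + d"
    by (rule increment_chaining[of "- 1" S L d "exp (- a\<^sup>2 / (2 * var S))" A \<kappa>,
          OF _ _ L d(1) _ A tail \<kappa>]) (use S in simp_all)
  have "AE \<omega> in completion M. \<omega> \<in> A - Bad \<longrightarrow> \<omega> \<in> ruin_event c S u T"
    unfolding AE_completion_iff using AE_cont
  proof (eventually_elim, intro impI)
    fix \<omega> assume cont: "continuous_on {0..} (\<lambda>t. X t \<omega>)" and \<omega>: "\<omega> \<in> A - Bad"
    have "risk_process X c u s \<omega> \<le> - 1" if s: "s \<in> {S..S + T}" for s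
    proof -
      have "a < X s \<omega> + d" using Bad(3)[OF \<omega> cont, of s] s T \<omega> by (auto simp: A_def)
      moreover have "c * s \<le> c * (S + L)" using s T c by (intro mult_left_mono) auto
      ultimately show ?thesis unfolding risk_process_def a by linarith
    qed
    then have "(SUP s\<in>{S..S + T}. ereal (risk_process X c u s \<omega>)) < 0"
      by (rule uniform_imp_SUP_ereal_less_0) simp_all
    then show "\<omega> \<in> ruin_event c S u T" using S \<omega>
      by (auto simp: ruin_event_def INF_less_iff A_def)
  qed
  moreover have "emeasure (completion M) (ruin_event c S u T) < \<top>"
    using emeasure_mono[of "ruin_event c S u T" "space M" "completion M"]
    by (auto simp: ruin_event_def emeasure_space_1 intro: le_less_trans)
  ultimately have "measure (completion M) (A - Bad) \<le> measure (completion M) (ruin_event c S u T)"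
    unfolding measure_def using sets_completion_ruin_event[OF S T(1)]
    by (intro enn2real_mono emeasure_mono_AE)
  moreover have "measure (completion M) (A - Bad) = prob (A - Bad)" using A Bad(1) by simp
  moreover have "prob A \<le> prob (A - Bad) + prob Bad"
    using measure_Un_le[of "A - Bad" M Bad] A Bad(1)
      finite_measure_mono[of A "(A - Bad) \<union> Bad"] by auto
  moreover have "exp (- (a + 1)\<^sup>2 / (2 * var S)) / sqrt (2 * pi * var S) \<le> prob A"
    unfolding A_def using S a_pos
    by (intro gaussian_tail_ge gaussian_X) (auto simp: expectation_X second_moment_X var_pos)
  ultimately show ?thesis using Bad(2) by linarith
qed

section \<open>Logarithmic asymptotics as \<open>u\<close> grows\<close>

text \<open>The allowance is \<open>d = \<epsilon> * u\<close>, while the number of grid intervals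
  depends on \<open>\<epsilon>\<close> alone and so enters only through the constant
  \<open>K\<close>.\<close>

lemma eventually_ruin_prob_le:
  assumes S: "S > 0" and c: "c > 0" and T: "\<And>u. u \<ge> 0 \<Longrightarrow> T u > 0" and \<epsilon>: "0 < \<epsilon>" "\<epsilon> < 1"
  obtains K where "K > 0"
    "\<forall>\<^sub>F u in at_top. measure (completion M) (ruin_event c S u (T u))
      \<le> K * exp (- (1 - \<epsilon>)\<^sup>2 * u\<^sup>2 / (2 * var S))"
proof -
  \<comment> \<open>With this \<open>N\<close>, convexity gives
    \<open>var (S / real N) \<le> \<epsilon>\<^sup>2 * var S / 8\<close>, just enough for the
    chaining exponent to be at least \<open>u\<^sup>2 / (2 * var S)\<close>.\<close>
  define N where "N = nat \<lceil>8 / \<epsilon>\<^sup>2\<rceil>"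
  have "8 / \<epsilon>\<^sup>2 > 0" using \<epsilon> by simp
  then have N: "N > 0" "8 / \<epsilon>\<^sup>2 \<le> real N" unfolding N_def by linarith+
  have V: "var S > 0" "var (S / real N) > 0" using S N by (auto intro: var_pos)
  have "var ((1 / real N) * S) \<le> (1 / real N) * var S"
    using convex_var var_0 S N by (intro convex_on_le_linear) auto
  then have VN: "var (S / real N) * real N \<le> var S" using N by (simp add: field_simps)
  have rate: "\<epsilon>\<^sup>2 / (16 * var (S / real N)) \<ge> 1 / (2 * var S)"
  proof -
    have "8 * var (S / real N) \<le> \<epsilon>\<^sup>2 * real N * var (S / real N)"
      using N(2) \<epsilon> V by (intro mult_right_mono) (simp_all add: field_simps)
    also have "\<dots> = \<epsilon>\<^sup>2 * (var (S / real N) * real N)" by simp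
    also have "\<dots> \<le> \<epsilon>\<^sup>2 * var S" by (intro mult_left_mono VN) simp
    finally show ?thesis using V by (simp add: field_simps)
  qed
  have "((\<lambda>u::real. exp (- (u\<^sup>2 / (2 * v)) / 8)) \<longlongrightarrow> 0) at_top" if "v > 0" for v :: real
    using that by real_asymp
  from this[OF V(1)]
  have small: "\<forall>\<^sub>F u::real in at_top. exp (- (u\<^sup>2 / (2 * var S)) / 8) < 1 / 4"
    by (rule order_tendstoD) simp
  have "\<forall>\<^sub>F u in at_top. measure (completion M) (ruin_event c S u (T u))
      \<le> 3 * real N * exp (- (1 - \<epsilon>)\<^sup>2 * u\<^sup>2 / (2 * var S))"
    using small eventually_gt_at_top[of 0]
  proof eventually_elim
    case (elim u)
    define \<kappa> where "\<kappa> = (\<epsilon> * u)\<^sup>2 / (16 * var (S / real N))"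
    have "u\<^sup>2 * (1 / (2 * var S)) \<le> u\<^sup>2 * (\<epsilon>\<^sup>2 / (16 * var (S / real N)))"
      by (intro mult_left_mono rate) simp
    then have \<kappa>: "u\<^sup>2 / (2 * var S) \<le> \<kappa>" by (simp add: \<kappa>_def power_mult_distrib mult.commute)
    then have "exp (- \<kappa> / 8) \<le> exp (- (u\<^sup>2 / (2 * var S)) / 8)" by simp
    then have "exp (- \<kappa> / 8) \<le> 1 / 4" using elim by linarith
    with elim \<epsilon> T N S c have "measure (completion M) (ruin_event c S u (T u))
        \<le> real N * (exp (- (u - \<epsilon> * u)\<^sup>2 / (2 * var S)) + 2 * exp (- \<kappa>))"
      by (intro ruin_prob_le \<kappa>_def) (auto simp: mult_le_cancel_right1)
    also have "\<dots> \<le> real N * (exp (- (1 - \<epsilon>)\<^sup>2 * u\<^sup>2 / (2 * var S))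
        + 2 * exp (- (1 - \<epsilon>)\<^sup>2 * u\<^sup>2 / (2 * var S)))"
    proof (intro mult_left_mono add_mono)
      have "(u - \<epsilon> * u)\<^sup>2 = (1 - \<epsilon>)\<^sup>2 * u\<^sup>2" by (simp add: power2_eq_square algebra_simps)
      then show "exp (- (u - \<epsilon> * u)\<^sup>2 / (2 * var S)) \<le> exp (- (1 - \<epsilon>)\<^sup>2 * u\<^sup>2 / (2 * var S))" by simp
      have "(1 - \<epsilon>)\<^sup>2 \<le> 1" using \<epsilon> by (intro power_le_one) auto
      then have "(1 - \<epsilon>)\<^sup>2 * u\<^sup>2 / (2 * var S) \<le> 1 * u\<^sup>2 / (2 * var S)"
        using V by (intro divide_right_mono mult_right_mono) auto
      then show "exp (- \<kappa>) \<le> exp (- (1 - \<epsilon>)\<^sup>2 * u\<^sup>2 / (2 * var S))" using \<kappa> by simp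
    qed simp_all
    finally show ?case by (simp add: algebra_simps)
  qed
  then show thesis using N by (intro that[of "3 * real N"]) auto
qed

text \<open>With \<open>d = \<epsilon> * u\<close> the level is
  \<open>a = (1 + \<epsilon>) * u\<close> plus a constant. The subtracted term carries
  \<open>exp (- k * u\<^sup>2)\<close>, whereas replacing \<open>a + 1\<close> by \<open>a\<close>
  in the exponential changes it by a factor with exponent linear in \<open>u\<close>. So at least
  half of the main term eventually survives.\<close>

lemma eventually_ruin_prob_ge:
  assumes S: "S > 0" and c: "c > 0" and T: "\<And>u. u \<ge> 0 \<Longrightarrow> 0 < T u \<and> T u \<le> L" and \<epsilon>: "0 < \<epsilon>"
  obtains C K where "C > 0"
    "\<forall>\<^sub>F u in at_top. C * exp (- ((1 + \<epsilon>) * u + K)\<^sup>2 / (2 * var S))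
      \<le> measure (completion M) (ruin_event c S u (T u))"
proof -
  define K where "K = c * (S + L) + 1"
  define C where "C = 1 / sqrt (2 * pi * var S)"
  define k where "k = \<epsilon>\<^sup>2 / (16 * var L)"
  have L: "L > 0" using T[of 0] by linarith
  have V: "var S > 0" "var L > 0" using S L by (auto intro: var_pos)
  have pos: "C > 0" "k > 0" using V \<epsilon> by (auto simp: C_def k_def)
  have "((\<lambda>u::real. exp (- (k * u\<^sup>2) / 8)) \<longlongrightarrow> 0) at_top"
    using pos by real_asymp
  then have small: "\<forall>\<^sub>F u::real in at_top. exp (- (k * u\<^sup>2) / 8) < 1 / 4"
    by (rule order_tendstoD) simp
  have "((\<lambda>u::real. 2 * exp (p * u + q - k * u\<^sup>2)) \<longlongrightarrow> 0) at_top" for p q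
    using pos by real_asymp
  moreover have "(2 * ((1 + \<epsilon>) * u + K) + 1) / (2 * var S)
      = (1 + \<epsilon>) / var S * u + (2 * K + 1) / (2 * var S)" for u
    using V by (simp add: field_simps)
  ultimately have "((\<lambda>u::real. 2 * exp ((2 * ((1 + \<epsilon>) * u + K) + 1) / (2 * var S) - k * u\<^sup>2)) \<longlongrightarrow> 0) at_top"
    by (simp only:)
  then have gap: "\<forall>\<^sub>F u::real in at_top.
      2 * exp ((2 * ((1 + \<epsilon>) * u + K) + 1) / (2 * var S) - k * u\<^sup>2) < C / 2"
    by (rule order_tendstoD) (use pos in simp)
  have "\<forall>\<^sub>F u in at_top. C / 2 * exp (- ((1 + \<epsilon>) * u + (K + 1))\<^sup>2 / (2 * var S))
      \<le> measure (completion M) (ruin_event c S u (T u))"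
    using small gap eventually_gt_at_top[of 0]
  proof eventually_elim
    case (elim u)
    define a where "a = (1 + \<epsilon>) * u + K"
    let ?E = "exp (- (a + 1)\<^sup>2 / (2 * var S))"
    have k: "k * u\<^sup>2 = (\<epsilon> * u)\<^sup>2 / (16 * var L)" by (simp add: k_def power_mult_distrib)
    have "?E / sqrt (2 * pi * var S) - 2 * exp (- a\<^sup>2 / (2 * var S)) * exp (- (k * u\<^sup>2))
        \<le> measure (completion M) (ruin_event c S u (T u))"
      using elim \<epsilon> S c T[of u]
      by (intro ruin_prob_ge[where L = L and d = "\<epsilon> * u"] k)
        (auto simp: a_def K_def algebra_simps)
    moreover have "2 * exp (- a\<^sup>2 / (2 * var S)) * exp (- (k * u\<^sup>2)) \<le> C / 2 * ?E"
    proof -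
      have "- a\<^sup>2 / (2 * var S) = (2 * a + 1) / (2 * var S) + - (a + 1)\<^sup>2 / (2 * var S)"
        by (simp add: power2_eq_square algebra_simps flip: add_divide_distrib diff_divide_distrib)
      then have "exp (- a\<^sup>2 / (2 * var S)) * exp (- (k * u\<^sup>2))
          = exp ((2 * a + 1) / (2 * var S) - k * u\<^sup>2) * ?E"
        by (simp flip: exp_add)
      moreover have "2 * exp ((2 * a + 1) / (2 * var S) - k * u\<^sup>2) * ?E \<le> C / 2 * ?E"
        using elim by (intro mult_right_mono) (auto simp: a_def)
      ultimately show ?thesis by simp
    qed
    moreover have "?E / sqrt (2 * pi * var S) = C * ?E" by (simp add: C_def)
    ultimately have "C / 2 * ?E \<le> measure (completion M) (ruin_event c S u (T u))" by simp
    moreover have "(1 + \<epsilon>) * u + (K + 1) = a + 1" by (simp add: a_def)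
    ultimately show ?case by (simp only:)
  qed
  then show thesis using pos by (intro that[of "C / 2" "K + 1"]) auto
qed

text \<open>For each \<open>\<epsilon>\<close> the two eventual bounds give the rate up to
  \<open>(1 + \<epsilon>)\<^sup>2\<close> or \<open>(1 - \<epsilon>)\<^sup>2\<close>. Given a number
  \<open>y\<close> on either side of the limit, \<open>\<epsilon>\<close> is fixed first, small
  enough to stay on the right side of \<open>y\<close>, and only then \<open>u\<close> tends to
  infinity.\<close>

lemma ruin_prob_log_asymp:
  assumes S: "S > 0" and c: "c > 0" and T: "\<And>u. u \<ge> 0 \<Longrightarrow> 0 < T u \<and> T u \<le> L"
  shows "((\<lambda>u. ln (measure (completion M) (ruin_event c S u (T u))) / u\<^sup>2)
    \<longlongrightarrow> - 1 / (2 * var S)) at_top"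
proof -
  let ?P = "\<lambda>u. measure (completion M) (ruin_event c S u (T u))"
  have V: "var S > 0" using S by (rule var_pos)
  have inv_square: "((\<lambda>u. l / u\<^sup>2) \<longlongrightarrow> 0) at_top" for l :: real by real_asymp
  have T_pos: "T u > 0" if "u \<ge> 0" for u using T[OF that] by simp
  show ?thesis
  proof (rule order_tendstoI)
    fix y :: real assume y: "y < - 1 / (2 * var S)"
    have "((\<lambda>\<epsilon>. - (1 + \<epsilon>)\<^sup>2 / (2 * var S)) \<longlongrightarrow> - 1 / (2 * var S)) (at_right 0)"
      using V by (auto intro!: tendsto_eq_intros)
    from order_tendstoD(1)[OF this y] eventually_at_right_less[of 0]
    have "\<forall>\<^sub>F \<epsilon> in at_right 0. y < - (1 + \<epsilon>)\<^sup>2 / (2 * var S) \<and> 0 < \<epsilon>" by (rule eventually_conj)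
    from eventually_happens'[OF trivial_limit_at_right_real this]
    obtain \<epsilon> where \<epsilon>: "y < - (1 + \<epsilon>)\<^sup>2 / (2 * var S)" "0 < \<epsilon>" by blast
    obtain C K where C: "C > 0" and ev: "\<forall>\<^sub>F u in at_top.
        C * exp (- ((1 + \<epsilon>) * u + K)\<^sup>2 / (2 * var S)) \<le> ?P u"
      using eventually_ruin_prob_ge[of S c T L \<epsilon>] S c T \<epsilon>(2) by blast
    have "((\<lambda>u. (ln C - ((1 + \<epsilon>) * u + K)\<^sup>2 / (2 * var S)) / u\<^sup>2)
        \<longlongrightarrow> - (1 + \<epsilon>)\<^sup>2 / (2 * var S)) at_top"
    proof -
      \<comment> \<open>After division by \<open>u\<^sup>2\<close> the shift \<open>K\<close>
        appears as \<open>K / u\<close> and disappears in the limit.\<close>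
      have "((\<lambda>u. K / u) \<longlongrightarrow> 0) at_top" by real_asymp
      then have "((\<lambda>u. ln C / u\<^sup>2 - ((1 + \<epsilon>) + K / u)\<^sup>2 / (2 * var S))
          \<longlongrightarrow> 0 - ((1 + \<epsilon>) + 0)\<^sup>2 / (2 * var S)) at_top"
        using V inv_square
        by (intro tendsto_diff tendsto_divide[where b = "2 * var S"] tendsto_power tendsto_add tendsto_const) auto
      moreover have "\<forall>\<^sub>F u in at_top. ln C / u\<^sup>2 - ((1 + \<epsilon>) + K / u)\<^sup>2 / (2 * var S)
          = (ln C - ((1 + \<epsilon>) * u + K)\<^sup>2 / (2 * var S)) / u\<^sup>2"
        using eventually_gt_at_top[of 0]
      proof eventually_elim
        case (elim u)
        then have "(1 + \<epsilon>) + K / u = ((1 + \<epsilon>) * u + K) / u" by (simp add: field_simps)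
        then show ?case by (simp add: power_divide diff_divide_distrib)
      qed
      ultimately have "((\<lambda>u. (ln C - ((1 + \<epsilon>) * u + K)\<^sup>2 / (2 * var S)) / u\<^sup>2)
          \<longlongrightarrow> 0 - ((1 + \<epsilon>) + 0)\<^sup>2 / (2 * var S)) at_top"
        by (rule Lim_transform_eventually)
      then show ?thesis by simp
    qed
    from order_tendstoD(1)[OF this \<epsilon>(1)] ev eventually_gt_at_top[of 0]
    show "\<forall>\<^sub>F u in at_top. y < ln (?P u) / u\<^sup>2"
    proof eventually_elim
      case (elim u)
      have "0 < C * exp (- ((1 + \<epsilon>) * u + K)\<^sup>2 / (2 * var S))" using C by simp
      then have "ln (C * exp (- ((1 + \<epsilon>) * u + K)\<^sup>2 / (2 * var S))) \<le> ln (?P u)"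
        using elim(2) by (intro ln_mono)
      then have "(ln C - ((1 + \<epsilon>) * u + K)\<^sup>2 / (2 * var S)) / u\<^sup>2 \<le> ln (?P u) / u\<^sup>2"
        using C by (intro divide_right_mono) (auto simp: ln_mult)
      then show ?case using elim by linarith
    qed
  next
    fix y :: real assume y: "- 1 / (2 * var S) < y"
    have "((\<lambda>\<epsilon>. - (1 - \<epsilon>)\<^sup>2 / (2 * var S)) \<longlongrightarrow> - 1 / (2 * var S)) (at_right 0)"
      using V by (auto intro!: tendsto_eq_intros)
    from order_tendstoD(2)[OF this y] eventually_at_right_real[OF zero_less_one]
    have "\<forall>\<^sub>F \<epsilon> in at_right 0. - (1 - \<epsilon>)\<^sup>2 / (2 * var S) < y \<and> \<epsilon> \<in> {0<..<1}"
      by (rule eventually_conj)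
    from eventually_happens'[OF trivial_limit_at_right_real this]
    obtain \<epsilon> where \<epsilon>: "- (1 - \<epsilon>)\<^sup>2 / (2 * var S) < y" "0 < \<epsilon>" "\<epsilon> < 1"
      by auto
    obtain K where K: "K > 0" and ev: "\<forall>\<^sub>F u in at_top.
        ?P u \<le> K * exp (- (1 - \<epsilon>)\<^sup>2 * u\<^sup>2 / (2 * var S))"
      using eventually_ruin_prob_le[of S c T \<epsilon>] S c T_pos \<epsilon>(2,3) by blast
    \<comment> \<open>The lower bound is used here too: it makes the probability positive, and
      \<open>ln\<close> is monotone only on positive arguments.\<close>
    obtain C K' where C: "C > 0" and ge: "\<forall>\<^sub>F u in at_top.
        C * exp (- ((1 + \<epsilon>) * u + K')\<^sup>2 / (2 * var S)) \<le> ?P u"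
      using eventually_ruin_prob_ge[of S c T L \<epsilon>] S c T \<epsilon>(2) by blast
    from ge have P_pos: "\<forall>\<^sub>F u in at_top. 0 < ?P u"
    proof eventually_elim
      case (elim u)
      have "0 < C * exp (- ((1 + \<epsilon>) * u + K')\<^sup>2 / (2 * var S))" using C by simp
      then show ?case using elim by linarith
    qed
    have "((\<lambda>u. ln K / u\<^sup>2 + - (1 - \<epsilon>)\<^sup>2 / (2 * var S)) \<longlongrightarrow> 0 + - (1 - \<epsilon>)\<^sup>2 / (2 * var S)) at_top"
      by (intro tendsto_add tendsto_const inv_square)
    then have lim: "((\<lambda>u. ln K / u\<^sup>2 + - (1 - \<epsilon>)\<^sup>2 / (2 * var S)) \<longlongrightarrow> - (1 - \<epsilon>)\<^sup>2 / (2 * var S)) at_top"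
      by simp
    from order_tendstoD(2)[OF lim \<epsilon>(1)] ev P_pos eventually_gt_at_top[of 0]
    show "\<forall>\<^sub>F u in at_top. ln (?P u) / u\<^sup>2 < y"
    proof eventually_elim
      case (elim u)
      have "ln (?P u) \<le> ln (K * exp (- (1 - \<epsilon>)\<^sup>2 * u\<^sup>2 / (2 * var S)))"
        using elim by (intro ln_mono) auto
      also have "\<dots> = ln K + - (1 - \<epsilon>)\<^sup>2 * u\<^sup>2 / (2 * var S)" using K by (simp add: ln_mult)
      finally have "ln (?P u) / u\<^sup>2 \<le> (ln K + - (1 - \<epsilon>)\<^sup>2 * u\<^sup>2 / (2 * var S)) / u\<^sup>2"
        by (intro divide_right_mono) auto
      also have "\<dots> = ln K / u\<^sup>2 + - (1 - \<epsilon>)\<^sup>2 / (2 * var S)"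
        using elim(4) by (simp add: add_divide_distrib diff_divide_distrib)
      finally show ?case using elim(1) by linarith
    qed
  qed
qed

end

theorem theorem3p2:
  fixes M :: "'a measure" and X :: "real \<Rightarrow> 'a \<Rightarrow> real"
    and c S :: real and T :: "real \<Rightarrow> real"
  assumes "prob_space M"
    and "gaussian_process M X"
    and "centered_process M X"
    and "ae_continuous_paths M X"
    and "AE \<omega> in M. X 0 \<omega> = 0"
    and "stationary_increments M X"
    and "variance_function M X differentiable_on {0..}"
    and "strict_mono_on {0..} (variance_function M X)"
    and "convex_on {0..} (variance_function M X)"
    and "c > 0"
    and "S > 0"
    and "\<And>u. u \<ge> 0 \<Longrightarrow> T u > 0"
    and "bounded (T ` {0..})"
    and "T \<in> borel_measurable (restrict_space borel {0..})"
  shows "((\<lambda>u. ln (parisian_ruin_prob M X c S u (T u)) / u\<^sup>2)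
           \<longlongrightarrow> - 1 / (2 * variance_function M X S)) at_top"
proof -
  interpret gaussian_stationary_increments M X
    by (intro gaussian_stationary_increments.intro gaussian_stationary_increments_axioms.intro assms)
  \<comment> \<open>One window length \<open>L\<close> valid for all \<open>u\<close> keeps the
    shift and the chaining variance in the lower bound independent of \<open>u\<close>.\<close>
  obtain L where "\<And>u. u \<ge> 0 \<Longrightarrow> \<bar>T u\<bar> \<le> L"
    using assms(13) by (auto simp: bounded_iff)
  then have "\<And>u. u \<ge> 0 \<Longrightarrow> 0 < T u \<and> T u \<le> L"
    using assms(12) by (meson abs_le_D1)
  from ruin_prob_log_asymp[of S c T L, OF assms(11,10) this] show ?thesis
    by (simp add: parisian_ruin_prob_def ruin_event_def)
qed

end
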